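(* Let $b\ge 2$ be an integer. For all integers $k,m$ with $2\leq m\leq k$, $s_b(G_k(m))=H_k(m)$.
   Context: Fix an integer $b\ge 2$. A base $b$ over-expansion of a positive integer $N$ is a word $d_kd_{k-1}\cdots d_0$ over $\{0,1,\ldots,b\}$ with $d_k\neq 0$ and $\sum_{i=0}^k d_ib^i=N$. For $n\ge 2$, $s_b(n)$ is the number of base $b$ over-expansions of $n-1$; $s_b(0)=0$, $s_b(1)=1$. The integers $h_m$ are defined by $h_1=h_2=1$ and, for $m\geq 3$, $h_m=1+\sum_{i=0}^{\lfloor (m-3)/2\rfloor}b^{m-2-2i}$. For integers $2\le m\le k$, $G_k(m)=b^k+h_m$ and $H_k(m)=F_{m+2}+(k-m)F_m$, where $F_j$ are the Fibonacci numbers with $F_1=F_2=1$. *)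

theory Defs
  imports "HOL-Number_Theory.Fib"
begin

text \<open>Words are written as lists with the most significant digit first, so the digit
  of weight \<open>b ^ i\<close> is \<open>rev w ! i\<close>.\<close>

definition over_expansion :: "nat \<Rightarrow> nat \<Rightarrow> nat list \<Rightarrow> bool" where
  "over_expansion b N w \<longleftrightarrow>
     w \<noteq> [] \<and> set w \<subseteq> {0..b} \<and> hd w \<noteq> 0 \<and> (\<Sum>i<length w. rev w ! i * b ^ i) = N"

definition s :: "nat \<Rightarrow> nat \<Rightarrow> nat" where
  "s b n = (if n = 0 then 0 else if n = 1 then 1 else card {w. over_expansion b (n - 1) w})"

text \<open>The value at \<open>m = 0\<close> is irrelevant. In the sum \<open>2 * i \<le> m - 3\<close>, so the
  subtractions do not truncate.\<close>

definition h :: "nat \<Rightarrow> nat \<Rightarrow> nat" where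
  "h b m = (if m \<le> 2 then 1 else 1 + (\<Sum>i=0..(m - 3) div 2. b ^ (m - 2 - 2 * i)))"

definition G :: "nat \<Rightarrow> nat \<Rightarrow> nat \<Rightarrow> nat" where
  "G b k m = b ^ k + h b m"

text \<open>Only used for \<open>m \<le> k\<close>, where the subtraction does not truncate.\<close>

definition H :: "nat \<Rightarrow> nat \<Rightarrow> nat" where
  "H k m = fib (m + 2) + (k - m) * fib m"

end

theory Submission imports Defs begin

text \<open>Let \<open>a N\<close> be the number of over-expansions of \<open>N\<close>, with \<open>a 0 = 1\<close> for the empty word.
  Removing the last digit gives \<open>a (b N + r) = a N\<close> for \<open>0 < r < b\<close> and
  \<open>a (b N) = a N + a (N - 1)\<close> for \<open>N > 0\<close>. With \<open>f k m = b ^ k + h m - 1\<close>, one of the numbers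
  \<open>f k m / b\<close> and \<open>f k m / b - 1\<close> is \<open>f (k - 1) (m - 1)\<close>, and the other is
  \<open>b f (k - 2) (m - 2) + r\<close> with \<open>r = 1\<close> or \<open>r = b - 1\<close>, depending on the parity of \<open>m\<close>. Hence
  \<open>a (f k m) = a (f (k - 1) (m - 1)) + a (f (k - 2) (m - 2))\<close>, the Fibonacci-type recurrence
  that \<open>H\<close> satisfies; for \<open>m = 1, 2\<close> both sides are \<open>a (b ^ k) = k + 1\<close>.\<close>

section \<open>Words, their values and removal of the last digit\<close>

definition word_val :: "nat \<Rightarrow> nat list \<Rightarrow> nat" where
  "word_val b w = (\<Sum>i<length w. rev w ! i * b ^ i)"

lemma word_val_Nil [simp]: "word_val b [] = 0"
  by (simp add: word_val_def)

lemma word_val_snoc [simp]: "word_val b (v @ [d]) = d + b * word_val b v"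
  unfolding word_val_def
  by (simp add: sum.lessThan_Suc_shift sum_distrib_left mult_ac del: sum.lessThan_Suc)

lemma word_val_singleton [simp]: "word_val b [d] = d"
  by (simp add: word_val_def)

definition expansions :: "nat \<Rightarrow> nat \<Rightarrow> nat list set" where
  "expansions b N = {w. set w \<subseteq> {0..b} \<and> (w \<noteq> [] \<longrightarrow> hd w \<noteq> 0) \<and> word_val b w = N}"

lemma expansions_0:
  assumes "b > 0"
  shows "expansions b 0 = {[]}"
proof -
  have "w = []" if "w \<noteq> [] \<longrightarrow> hd w \<noteq> 0" "word_val b w = 0" for w
    using that
  proof (induction w rule: rev_induct)
    case (snoc d v)
    then show ?case
      using assms by (cases "v = []") auto
  qed simp
  then show ?thesis
    by (auto simp: expansions_def)
qed

text \<open>\<open>N > 0\<close> excludes the word \<open>[0]\<close>: its prefix is an expansion of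
  0, but its leading digit vanishes.\<close>

lemma snoc_in_expansions_iff:
  assumes "N > 0"
  shows "v @ [d] \<in> expansions b N \<longleftrightarrow>
    d \<le> b \<and> v \<in> expansions b (word_val b v) \<and> N = d + b * word_val b v"
  using assms by (cases "v = []") (auto simp: expansions_def)

text \<open>Modulo \<open>b\<close> the last digit is congruent to \<open>r\<close>, and for
  \<open>0 < r < b\<close> only \<open>r\<close> itself qualifies among the digits up to
  \<open>b\<close>.\<close>

lemma expansions_digit:
  assumes "0 < r" "r < b"
  shows "expansions b (b * N + r) = (\<lambda>v. v @ [r]) ` expansions b N"
proof (intro set_eqI iffI)
  fix w assume w: "w \<in> expansions b (b * N + r)"
  then have "w \<noteq> []"
    using assms by (auto simp: expansions_def)
  then obtain v d where wv: "w = v @ [d]"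
    by (metis rev_exhaust)
  then have d: "d \<le> b" "v \<in> expansions b (word_val b v)" "b * N + r = d + b * word_val b v"
    using w assms by (auto simp: snoc_in_expansions_iff)
  have "d \<noteq> b"
  proof
    assume "d = b"
    then have "(b * N + r) mod b = 0"
      using d(3) by simp
    then show False
      using assms by simp
  qed
  then have "d < b"
    using d(1) by simp
  have "d = (b * N + r) mod b" "word_val b v = (b * N + r) div b"
    using \<open>d < b\<close> by (simp_all add: d(3))
  then show "w \<in> (\<lambda>v. v @ [r]) ` expansions b N"
    using wv d(2) assms by simp
next
  fix w assume "w \<in> (\<lambda>v. v @ [r]) ` expansions b N"
  then obtain v where "w = v @ [r]" "v \<in> expansions b N" by blast
  moreover from this have "word_val b v = N"
    by (simp add: expansions_def)
  ultimately show "w \<in> expansions b (b * N + r)"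
    using assms by (simp add: snoc_in_expansions_iff)
qed

text \<open>Here two last digits fit the residue: 0, and \<open>b\<close>, which takes one unit away
  from the quotient.\<close>

lemma expansions_mult:
  assumes "b > 0" "N > 0"
  shows "expansions b (b * N) =
    (\<lambda>v. v @ [0]) ` expansions b N \<union> (\<lambda>v. v @ [b]) ` expansions b (N - 1)"
proof (intro set_eqI iffI)
  fix w assume w: "w \<in> expansions b (b * N)"
  then have "w \<noteq> []"
    using assms by (auto simp: expansions_def)
  then obtain v d where wv: "w = v @ [d]"
    by (metis rev_exhaust)
  then have d: "d \<le> b" "v \<in> expansions b (word_val b v)" "b * N = d + b * word_val b v"
    using w assms by (auto simp: snoc_in_expansions_iff)
  then have "b dvd d"
    by (metis dvd_add_left_iff dvd_triv_left)
  then consider "d = 0" | "d = b"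
    using d(1) by (metis dvd_imp_le le_antisym neq0_conv)
  then show "w \<in> (\<lambda>v. v @ [0]) ` expansions b N \<union> (\<lambda>v. v @ [b]) ` expansions b (N - 1)"
  proof cases
    case 1
    then show ?thesis
      using wv d(2,3) assms by simp
  next
    case 2
    then have "b * N = b * Suc (word_val b v)"
      using d(3) by simp
    then have "N = Suc (word_val b v)"
      using assms by (simp only: mult_cancel1) simp
    then have "word_val b v = N - 1"
      by simp
    then show ?thesis
      using wv d(2) 2 by auto
  qed
next
  fix w assume "w \<in> (\<lambda>v. v @ [0]) ` expansions b N \<union> (\<lambda>v. v @ [b]) ` expansions b (N - 1)"
  then consider v where "w = v @ [0]" "v \<in> expansions b N"
    | v where "w = v @ [b]" "v \<in> expansions b (N - 1)" by blast
  then show "w \<in> expansions b (b * N)"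
  proof cases
    case 1
    moreover from this have "word_val b v = N"
      by (simp add: expansions_def)
    ultimately show ?thesis
      using assms by (simp add: snoc_in_expansions_iff)
  next
    case 2
    moreover from this have "word_val b v = N - 1"
      by (simp add: expansions_def)
    moreover have "b * N = b + b * (N - 1)"
      using assms by (cases N) auto
    ultimately show ?thesis
      using assms by (simp add: snoc_in_expansions_iff)
  qed
qed

text \<open>Finiteness makes \<open>card\<close> additive on the disjoint union in
  \<open>expansions_mult\<close>.\<close>

lemma finite_expansions:
  assumes "b \<ge> 2"
  shows "finite (expansions b N)"
proof (induction N rule: less_induct)
  case (less N)
  show ?case
  proof (cases "N = 0")
    case True
    then show ?thesis
      using assms by (simp add: expansions_0)
  next
    case False
    define q r where "q = N div b" and "r = N mod b"
    have N: "N = b * q + r" and "r < b" and "q < N"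
      using assms False by (simp_all add: q_def r_def)
    show ?thesis
    proof (cases "r = 0")
      case True
      then have "q > 0"
        using N False by (cases q) auto
      moreover have "finite (expansions b q)" "finite (expansions b (q - 1))"
        using less \<open>q < N\<close> by simp_all
      ultimately show ?thesis
        using True N assms by (simp add: expansions_mult)
    next
      case False
      then show ?thesis
        using N \<open>r < b\<close> less \<open>q < N\<close> by (simp add: expansions_digit)
    qed
  qed
qed

section \<open>Recurrences for the counts and their values near powers of \<open>b\<close>\<close>

lemma card_expansions_digit:
  assumes "0 < r" "r < b"
  shows "card (expansions b (b * N + r)) = card (expansions b N)"
  using assms by (simp add: expansions_digit card_image inj_on_def)

lemma card_expansions_mult:
  assumes "b \<ge> 2" "N > 0"
  shows "card (expansions b (b * N)) = card (expansions b N) + card (expansions b (N - 1))"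
proof -
  have "card (expansions b (b * N)) =
    card ((\<lambda>v. v @ [0]) ` expansions b N) + card ((\<lambda>v. v @ [b]) ` expansions b (N - 1))"
    using assms by (subst expansions_mult) (auto intro!: card_Un_disjoint simp: finite_expansions)
  then show ?thesis
    by (simp add: card_image inj_on_def)
qed

lemma s_Suc_eq_card_expansions:
  assumes "b > 0"
  shows "s b (Suc N) = card (expansions b N)"
proof (cases "N = 0")
  case True
  then show ?thesis
    using assms by (simp add: s_def expansions_0)
next
  case False
  \<comment> \<open>The two sets could differ only in the empty word, whose value 0 is not
    \<open>N\<close>.\<close>
  then have "{w. over_expansion b N w} = expansions b N"
    by (auto simp: over_expansion_def expansions_def simp flip: word_val_def)
  then show ?thesis
    using False by (simp add: s_def)
qed

text \<open>In base \<open>b\<close> this number consists of \<open>k\<close> digits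
  \<open>b - 1\<close>, each of which is forced from the right.\<close>

lemma card_expansions_power_minus_1:
  assumes "b \<ge> 2"
  shows "card (expansions b (b ^ k - 1)) = 1"
proof (induction k)
  case 0
  then show ?case
    using assms by (simp add: expansions_0)
next
  case (Suc k)
  have "b * b ^ k = b * (b ^ k - 1) + b"
    using assms by (simp add: diff_mult_distrib2)
  then have "b ^ Suc k - 1 = b * (b ^ k - 1) + (b - 1)"
    using assms by simp
  then show ?case
    using Suc assms card_expansions_digit[of "b - 1" b "b ^ k - 1"] by simp
qed

lemma card_expansions_power:
  assumes "b \<ge> 2"
  shows "card (expansions b (b ^ k)) = k + 1"
proof (induction k)
  case 0
  have "card (expansions b (b * 0 + 1)) = card (expansions b 0)"
    using assms by (intro card_expansions_digit) auto
  then show ?case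
    using assms by (simp add: expansions_0)
next
  case (Suc k)
  then show ?case
    using assms card_expansions_mult[of b "b ^ k"] card_expansions_power_minus_1[of b k] by simp
qed

section \<open>The digit pattern of \<open>h\<close>\<close>

text \<open>\<open>alternating b n\<close> is \<open>h b (n + 1) - 1\<close>, in base \<open>b\<close> the word \<open>\<dots>10101\<close> followed
  by one or two zeros.\<close>

fun alternating :: "nat \<Rightarrow> nat \<Rightarrow> nat" where
  "alternating b 0 = 0"
| "alternating b (Suc n) = b * alternating b n + (if odd n then b else 0)"

text \<open>The definition appends digits at the low end; this splits off the leading power, as
  \<open>h_add_2\<close> does for \<open>h\<close>.\<close>

lemma alternating_Suc_Suc: "alternating b (Suc (Suc n)) = b ^ Suc n + alternating b n"
  by (induction n) (auto simp: algebra_simps)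

lemma h_add_2:
  assumes "m \<ge> 1"
  shows "h b (m + 2) = b ^ m + h b m"
proof (cases "m \<le> 2")
  case True
  then have "m = 1 \<or> m = 2"
    using assms by auto
  then show ?thesis
    by (auto simp: h_def)
next
  case False
  \<comment> \<open>The sum for \<open>m + 2\<close> has one more term, its first,
    \<open>b ^ m\<close>; shifting the index turns the rest into the sum for
    \<open>m\<close>.\<close>
  then have "(m - 1) div 2 = Suc ((m - 3) div 2)"
    by presburger
  then show ?thesis
    using False by (simp add: h_def sum.atLeast0_atMost_Suc_shift del: sum.cl_ivl_Suc)
qed

lemma h_Suc: "h b (Suc n) = Suc (alternating b n)"
proof (induction n rule: induct_nat_012)
  case (ge2 n)
  then show ?case
    using h_add_2[of "Suc n" b] alternating_Suc_Suc[of b n] by simp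
qed (auto simp: h_def)

section \<open>The Fibonacci recurrence\<close>

lemma card_expansions_power_plus_alternating_step:
  assumes "b \<ge> 2"
  shows "card (expansions b (b ^ (k + 2) + alternating b (n + 2))) =
    card (expansions b (b ^ (k + 1) + alternating b (n + 1))) +
    card (expansions b (b ^ k + alternating b n))"
proof (cases "odd n")
  case True
  define M where "M = b ^ (k + 1) + alternating b (n + 1)"
  have "b ^ (k + 2) + alternating b (n + 2) = b * M"
    using True by (simp add: M_def algebra_simps)
  moreover have "M > 0"
    using assms by (simp add: M_def)
  \<comment> \<open>For odd \<open>n\<close>, \<open>M\<close> ends in the digit 0, so subtracting 1
    borrows and leaves the last digit \<open>b - 1\<close>.\<close>
  moreover have "M - 1 = b * (b ^ k + alternating b n) + (b - 1)"
    using True assms by (simp add: M_def algebra_simps)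
  ultimately show ?thesis
    using assms card_expansions_mult[of b M] card_expansions_digit[of "b - 1" b]
    by (simp add: M_def)
next
  case False
  define M where "M = b ^ (k + 1) + alternating b (n + 1)"
  \<comment> \<open>For even \<open>n\<close> the quotient is \<open>M + 1\<close>, so
    \<open>M\<close> is now the count reached through the last digit \<open>b\<close>.\<close>
  have "b ^ (k + 2) + alternating b (n + 2) = b * (M + 1)"
    using False by (simp add: M_def algebra_simps)
  moreover have "M + 1 = b * (b ^ k + alternating b n) + 1"
    using False by (simp add: M_def algebra_simps)
  ultimately show ?thesis
    using assms card_expansions_mult[of b "M + 1"] card_expansions_digit[of 1 b]
    by (simp add: M_def)
qed

text \<open>With \<open>m = n + 1\<close> and \<open>k = m + j\<close>, the recurrence lowers
  \<open>k\<close> and \<open>m\<close> equally. Thus \<open>j\<close> stays fixed and induction on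
  \<open>n\<close> alone suffices.\<close>

lemma card_expansions_power_plus_alternating:
  assumes "b \<ge> 2"
  shows "card (expansions b (b ^ (n + 1 + j) + alternating b n)) = fib (n + 3) + j * fib (n + 1)"
proof (induction n rule: induct_nat_012)
  case 0
  then show ?case
    using card_expansions_power[OF assms, of "Suc j"] by (simp add: numeral_3_eq_3)
next
  case 1
  then show ?case
    using card_expansions_power[OF assms, of "Suc (Suc j)"] by (simp add: eval_nat_numeral)
next
  case (ge2 n)
  then show ?case
    using card_expansions_power_plus_alternating_step[OF assms, of "n + 1 + j" n]
    by (simp add: eval_nat_numeral algebra_simps)
qed

theorem theorem25:
  fixes b k m :: nat
  assumes "b \<ge> 2" and "2 \<le> m" and "m \<le> k"
  shows "s b (G b k m) = H k m"
proof -
  obtain n where m: "m = Suc n"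
    using assms(2) by (cases m) auto
  obtain j where k: "k = n + 1 + j"
    using assms(3) m by (auto simp: le_iff_add)
  have "s b (G b k m) = card (expansions b (b ^ k + alternating b n))"
    using assms(1) by (simp add: G_def m h_Suc s_Suc_eq_card_expansions)
  also have "\<dots> = H k m"
    using card_expansions_power_plus_alternating[OF assms(1), of n j]
    by (simp add: H_def m k eval_nat_numeral)
  finally show ?thesis .
qed

end
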